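(* Let $\mathfrak{g}$ be a nilpotent Lie algebra over the field $\mathbb{F}_2$, and let $n$ be a non-negative integer such that $\dim[\mathfrak{g},\mathfrak{g}] > n(n-1)/2$. Then there do not exist two proper Lie subalgebras $\mathfrak{h}_1,\mathfrak{h}_2$ of $\mathfrak{g}$, with $\mathfrak{h}_2$ of codimension at least $2$ in $\mathfrak{g}$, such that every element $x\in\mathfrak{g}$ with $b(x)\ge n$ lies in $\mathfrak{h}_1\cup\mathfrak{h}_2$.
   Context: For an element $x$ of a Lie algebra $\mathfrak{g}$ over a field, the centralizer is $C_{\mathfrak{g}}(x)=\{y\in\mathfrak{g} : [x,y]=0\}$, and the breadth of $x$ is $b(x)=\dim\mathfrak{g}-\dim C_{\mathfrak{g}}(x)$, i.e. the codimension of $C_{\mathfrak{g}}(x)$ in $\mathfrak{g}$ (a non-negative integer or $\infty$). $\mathfrak{g}'=[\mathfrak{g},\mathfrak{g}]$ denotes the derived subalgebra. *)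

theory Defs
  imports Main "HOL-Library.Z2" "HOL-Library.Extended_Nat"
begin

definition lie_algebra :: "(bit \<Rightarrow> 'a::ab_group_add \<Rightarrow> 'a) \<Rightarrow> ('a \<Rightarrow> 'a \<Rightarrow> 'a) \<Rightarrow> bool" where
  "lie_algebra s br \<longleftrightarrow>
     vector_space s \<and>
     (\<forall>x. Vector_Spaces.linear s s (br x)) \<and>
     (\<forall>y. Vector_Spaces.linear s s (\<lambda>x. br x y)) \<and>
     (\<forall>x. br x x = 0) \<and>
     (\<forall>x y z. br x (br y z) + br y (br z x) + br z (br x y) = 0)"

definition lie_subalgebra :: "(bit \<Rightarrow> 'a::ab_group_add \<Rightarrow> 'a) \<Rightarrow> ('a \<Rightarrow> 'a \<Rightarrow> 'a) \<Rightarrow> 'a set \<Rightarrow> bool" where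
  "lie_subalgebra s br H \<longleftrightarrow> module.subspace s H \<and> (\<forall>x\<in>H. \<forall>y\<in>H. br x y \<in> H)"

fun lower_central :: "(bit \<Rightarrow> 'a::ab_group_add \<Rightarrow> 'a) \<Rightarrow> ('a \<Rightarrow> 'a \<Rightarrow> 'a) \<Rightarrow> nat \<Rightarrow> 'a set" where
  "lower_central s br 0 = UNIV"
| "lower_central s br (Suc k) = module.span s {br x y | x y. y \<in> lower_central s br k}"

definition nilpotent_lie :: "(bit \<Rightarrow> 'a::ab_group_add \<Rightarrow> 'a) \<Rightarrow> ('a \<Rightarrow> 'a \<Rightarrow> 'a) \<Rightarrow> bool" where
  "nilpotent_lie s br \<longleftrightarrow> (\<exists>k. lower_central s br k = {0})"

definition derived :: "(bit \<Rightarrow> 'a::ab_group_add \<Rightarrow> 'a) \<Rightarrow> ('a \<Rightarrow> 'a \<Rightarrow> 'a) \<Rightarrow> 'a set" where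
  "derived s br = module.span s {br x y | x y. True}"

text \<open>Dimension of a subspace V (possibly infinite): the least size of a finite
  spanning set, and \<infinity> if there is none.\<close>
definition edim :: "(bit \<Rightarrow> 'a::ab_group_add \<Rightarrow> 'a) \<Rightarrow> 'a set \<Rightarrow> enat" where
  "edim s V = Inf {enat (card B) | B. finite B \<and> B \<subseteq> V \<and> module.span s B = V}"

text \<open>Codimension of a subspace H in the whole algebra (= dim of the quotient):
  the least number of vectors which together with H span everything, \<infinity> if none.\<close>
definition codim :: "(bit \<Rightarrow> 'a::ab_group_add \<Rightarrow> 'a) \<Rightarrow> 'a set \<Rightarrow> enat" where
  "codim s H = Inf {enat (card B) | B. finite B \<and> module.span s (H \<union> B) = UNIV}"

definition centralizer :: "('a \<Rightarrow> 'a \<Rightarrow> 'a::zero) \<Rightarrow> 'a \<Rightarrow> 'a set" where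
  "centralizer br x = {y. br x y = 0}"

definition breadth :: "(bit \<Rightarrow> 'a::ab_group_add \<Rightarrow> 'a) \<Rightarrow> ('a \<Rightarrow> 'a \<Rightarrow> 'a) \<Rightarrow> 'a \<Rightarrow> enat" where
  "breadth s br x = codim s (centralizer br x)"

end

theory Submission
  imports Defs
begin

text \<open>
  Only the alternating bilinear map \<open>b\<close> given by the bracket matters. Enlarge \<open>h1\<close> to a hyperplane and
  suppose that \<open>I u = range (b u)\<close> has dimension at most \<open>m = n - 1\<close> for all \<open>u\<close> outside \<open>h1 \<union> h2\<close>.
  Take such a \<open>y\<close> with \<open>dim (I y) = m\<close> and a hyperplane \<open>H'\<close> containing \<open>h2\<close> and \<open>y\<close>. Modulo \<open>I y\<close>,
  every \<open>x\<close> outside \<open>H'\<close> has breadth at most \<open>m - 1\<close>, because \<open>I x\<close> and \<open>I y\<close> meet nontrivially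
  when both have dimension \<open>m\<close>; by induction the image of \<open>b\<close> spans at most
  \<open>m + (m - 1) + \<dots> + 1\<close> dimensions. Over \<open>F\<^sub>2\<close> dimensions are measured by cardinalities of
  finite subspaces.
\<close>

section \<open>Vector spaces over \<open>F_2\<close> and cardinalities of their finite
  subspaces\<close>

locale bit_vector_space = vector_space s
  for s :: "bit \<Rightarrow> 'a::ab_group_add \<Rightarrow> 'a"
begin

lemma add_self [simp]: "x + x = (0::'a)"
proof -
  have "x + x = s (1 + 1) x"
    by (simp only: scale_left_distrib scale_one)
  then show ?thesis by simp
qed

lemma add_self_left [simp]: "x + (x + y) = (y::'a)"
  by (simp flip: add.assoc)

lemma minus_eq_self [simp]: "- x = (x::'a)"
  by (rule minus_unique) simp

lemma diff_eq_add: "x - y = x + (y::'a)"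
  by (simp only: diff_conv_add_uminus minus_eq_self)

lemma add_eq_0_iff_eq: "x + y = 0 \<longleftrightarrow> x = (y::'a)"
  by (simp flip: diff_eq_add)

lemma subspaceI_add:
  assumes "0 \<in> S" "\<And>x y. x \<in> S \<Longrightarrow> y \<in> S \<Longrightarrow> x + y \<in> S"
  shows "subspace S"
proof (rule subspaceI)
  show "s c x \<in> S" if "x \<in> S" for c x
    using that assms(1) by (cases c) auto
qed (use assms in auto)

lemma subspace_add_iff:
  assumes "subspace S" "x \<in> S"
  shows "x + y \<in> S \<longleftrightarrow> y \<in> S"
  using subspace_add[OF assms] subspace_add[OF assms, of "x + y"] by auto

lemma span_insert_cases:
  assumes "x \<in> span (insert a S)"
  shows "x \<in> span S \<or> x + a \<in> span S"
proof -
  obtain k where "x - s k a \<in> span S"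
    using assms by (auto simp: span_insert)
  then show ?thesis
    by (cases k) (auto simp: diff_eq_add)
qed

text \<open>Since \<open>v + v = 0\<close> and \<open>v \<noteq> 0\<close>, translation by
  \<open>v\<close> is an involution without fixed points, so a finite \<open>A\<close> splits into
  pairs; an infinite \<open>A\<close> has \<open>card A = 0\<close>.\<close>

lemma even_card_translation_invariant:
  fixes v :: 'a
  assumes "v \<noteq> 0" "\<And>z. z \<in> A \<Longrightarrow> z + v \<in> A"
  shows "even (card A)"
proof (cases "finite A")
  case True
  then show ?thesis using assms
  proof (induction "card A" arbitrary: A rule: less_induct)
    case less
    show ?case
    proof (cases "A = {}")
      case False
      then obtain z where z: "z \<in> A" by blast
      let ?A = "A - {z, z + v}"
      have zv: "z + v \<noteq> z" "z + v \<in> A" using less.prems z by auto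
      have "card ?A = card A - 2"
        using z zv less.prems(1) by (subst card_Diff_subset) auto
      moreover have "card {z, z + v} \<le> card A"
        using z zv less.prems(1) by (intro card_mono) auto
      then have "card A \<ge> 2" using zv(1) by (simp add: card_insert_if)
      moreover have "even (card ?A)"
      proof (rule less.hyps)
        show "card ?A < card A"
          using z less.prems(1) by (intro psubset_card_mono) auto
        show "w + v \<in> ?A" if w: "w \<in> ?A" for w
        proof -
          have "w + v \<noteq> z"
          proof
            assume "w + v = z"
            then have "z + v = w" by (auto simp: add.assoc)
            with w show False by auto
          qed
          moreover have "w + v \<noteq> z + v" using w by auto
          ultimately show ?thesis using less.prems w by auto
        qed
      qed (use less.prems in auto)
      ultimately show ?thesis by (simp add: even_diff_nat)
    qed auto
  qed
qed auto

lemma even_card_subspace: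
  assumes "subspace S" "v \<in> S" "v \<noteq> 0"
  shows "even (card S)"
  using assms by (intro even_card_translation_invariant[of v]) (auto intro: subspace_add)

text \<open>Each new basis vector \<open>b\<close> doubles the span: to \<open>span B\<close> it
  adds exactly one disjoint translate, \<open>span B + b\<close>.\<close>

lemma card_span_independent:
  assumes "finite B" "independent B"
  shows "finite (span B) \<and> card (span B) = 2 ^ card B"
  using assms
proof (induction B rule: finite_induct)
  case (insert b B)
  have B: "finite (span B)" "card (span B) = 2 ^ card B" and b: "b \<notin> span B"
    using insert by (auto simp: independent_insert)
  have eq: "span (insert b B) = span B \<union> (\<lambda>x. x + b) ` span B"
  proof (intro equalityI subsetI)
    fix x assume x: "x \<in> span (insert b B)"
    have "x = (x + b) + b" by (simp add: add.assoc)
    then show "x \<in> span B \<union> (\<lambda>x. x + b) ` span B"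
      using span_insert_cases[OF x] by blast
  next
    fix x assume "x \<in> span B \<union> (\<lambda>x. x + b) ` span B"
    then show "x \<in> span (insert b B)"
      using span_mono[of B "insert b B"] span_base[of b "insert b B"] by (auto intro!: span_add)
  qed
  have "span B \<inter> (\<lambda>x. x + b) ` span B = {}"
    using b subspace_add_iff[OF subspace_span] by fastforce
  moreover have "card ((\<lambda>x. x + b) ` span B) = card (span B)"
    by (intro card_image) auto
  ultimately show ?case
    using insert B by (auto simp: eq card_Un_disjoint)
qed auto

lemma card_span_le:
  assumes "finite B"
  shows "finite (span B) \<and> card (span B) \<le> 2 ^ card B"
proof -
  obtain B' where B': "B' \<subseteq> B" "independent B'" "B \<subseteq> span B'"
    using maximal_independent_subset by blast
  have "span B' = span B"
    using B' by (metis span_eq span_superset subset_trans)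
  moreover have "finite B'" "card B' \<le> card B"
    using B' assms by (auto intro: finite_subset card_mono)
  ultimately show ?thesis
    using card_span_independent[of B'] B' by (metis one_le_numeral power_increasing)
qed

lemma finite_subspace_basis:
  assumes "subspace S" "finite S"
  obtains B where "finite B" "B \<subseteq> S" "span B = S" "card S = 2 ^ card B"
proof -
  obtain B where B: "B \<subseteq> S" "independent B" "S \<subseteq> span B"
    using maximal_independent_subset by blast
  have "span B = S"
    using B assms(1) by (meson span_minimal subset_antisym)
  moreover have "finite B"
    using B assms(2) finite_subset by blast
  ultimately show ?thesis
    using that B card_span_independent[of B] by metis
qed

section \<open>Hyperplanes over \<open>F_2\<close>\<close>

definition hyperplane :: "'a set \<Rightarrow> bool" where
  "hyperplane H \<longleftrightarrow> subspace H \<and> H \<noteq> UNIV \<and> (\<forall>u v. u \<notin> H \<longrightarrow> v \<notin> H \<longrightarrow> u + v \<in> H)"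

text \<open>A hyperplane over \<open>F_2\<close> has exactly one other coset, so membership in
  \<open>H\<close> behaves like the vanishing of a linear functional with values in
  \<open>F_2\<close>.\<close>

lemma hyperplane_add_iff:
  assumes "hyperplane H"
  shows "u + v \<in> H \<longleftrightarrow> (u \<in> H \<longleftrightarrow> v \<in> H)"
  using assms subspace_add_iff[of H u v] subspace_add_iff[of H v u]
  by (auto simp: hyperplane_def add.commute)

text \<open>Extend a basis of \<open>S\<close> together with \<open>y\<close> to a basis
  \<open>C\<close> of the whole space; deleting \<open>y\<close> from \<open>C\<close> leaves a
  basis of the hyperplane.\<close>

lemma separating_hyperplane:
  assumes "subspace S" "y \<notin> S"
  obtains H where "hyperplane H" "S \<subseteq> H" "y \<notin> H"
proof -
  obtain B where B: "B \<subseteq> S" "independent B" "S \<subseteq> span B"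
    using maximal_independent_subset by blast
  have SB: "span B = S"
    using B assms(1) by (meson span_minimal subset_antisym)
  then have "independent (insert y B)"
    using assms B by (auto simp: independent_insert)
  then obtain C where C: "insert y B \<subseteq> C" "independent C" "UNIV \<subseteq> span C"
    using maximal_independent_subset_extend[of "insert y B" UNIV] by auto
  let ?H = "span (C - {y})"
  have y: "y \<notin> ?H"
    using C by (auto simp: dependent_def)
  have yC: "insert y (C - {y}) = C" using C by auto
  have add_y: "u + y \<in> ?H" if "u \<notin> ?H" for u
    using span_insert_cases[of u y "C - {y}"] that C(3) unfolding yC by auto
  have "u + v \<in> ?H" if "u \<notin> ?H" "v \<notin> ?H" for u v
  proof -
    have "(u + y) + (v + y) \<in> ?H" using that by (intro span_add add_y)
    then show ?thesis by (simp add: ac_simps)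
  qed
  then have "hyperplane ?H"
    using y by (auto simp: hyperplane_def)
  moreover have "B \<subseteq> C - {y}" using C(1) B(1) assms(2) by auto
  then have "S \<subseteq> ?H" using span_mono SB by blast
  ultimately show ?thesis using that y by blast
qed

text \<open>The second hypothesis expresses that \<open>h\<close> has codimension at least 2, so
  there is room for one more prescribed vector \<open>y\<close> below a hyperplane.\<close>

lemma hyperplane_above:
  assumes "subspace h" "\<And>y. span (insert y h) \<noteq> UNIV"
  obtains H where "hyperplane H" "h \<subseteq> H" "y \<in> H"
proof -
  obtain z where "z \<notin> span (insert y h)" using assms(2) by blast
  then obtain H where "hyperplane H" "span (insert y h) \<subseteq> H"
    using separating_hyperplane[OF subspace_span] by blast
  then show ?thesis using that span_superset[of "insert y h"] by auto
qed

text \<open>Two proper subspaces never cover the space: with \<open>u\<close> outside one and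
  \<open>v\<close> outside the other, one of \<open>u\<close>, \<open>v\<close>,
  \<open>u + v\<close> avoids both.\<close>

lemma exists_outside_both:
  assumes "hyperplane H" "subspace h" "\<And>y. span (insert y h) \<noteq> UNIV"
  obtains y where "y \<notin> H" "y \<notin> h"
proof -
  obtain L where L: "hyperplane L" "h \<subseteq> L" using hyperplane_above[OF assms(2,3)] by blast
  obtain u v where uv: "u \<notin> H" "v \<notin> L"
    using assms(1) L(1) by (auto simp: hyperplane_def)
  then have "u \<notin> L \<or> v \<notin> H \<or> (u + v \<notin> H \<and> u + v \<notin> L)"
    by (simp add: hyperplane_add_iff[OF assms(1)] hyperplane_add_iff[OF L(1)])
  then show ?thesis using that uv L(2) by blast
qed

section \<open>Linear maps and a common complement of two kernels\<close>

lemma linear_add_map: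
  assumes "Vector_Spaces.linear s s f"
  shows "f (x + y) = f x + f y"
  using assms by (simp add: Vector_Spaces.linear_iff)

lemma linear_zero_map:
  assumes "Vector_Spaces.linear s s f"
  shows "f 0 = 0"
  using linear_add_map[OF assms, of 0 0] by simp

lemma common_complement:
  assumes f: "Vector_Spaces.linear s s f" and g: "Vector_Spaces.linear s s g"
    and K: "subspace K" and fK: "f ` K = range f" and gK: "g ` K = range g"
    and fin: "finite (range f)" and card_eq: "card (range g) = card (range f)"
  obtains Z where "subspace Z" "Z \<subseteq> K" "finite Z" "card Z = card (range f)"
    "\<And>z. z \<in> Z \<Longrightarrow> f z = 0 \<Longrightarrow> z = 0" "\<And>z. z \<in> Z \<Longrightarrow> g z = 0 \<Longrightarrow> z = 0"
proof -
  define P where "P Z \<longleftrightarrow> subspace Z \<and> Z \<subseteq> K \<and> (\<forall>z\<in>Z. f z = 0 \<longrightarrow> z = 0) \<and>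
    (\<forall>z\<in>Z. g z = 0 \<longrightarrow> z = 0)" for Z
  note add_f = linear_add_map[OF f] and add_g = linear_add_map[OF g]
  have inj: "inj_on h Z"
    if "Vector_Spaces.linear s s h" "subspace Z" "\<forall>z\<in>Z. h z = 0 \<longrightarrow> z = 0" for h Z
  proof (rule inj_onI)
    fix u v assume "u \<in> Z" "v \<in> Z" "h u = h v"
    then have "h (u + v) = 0" "u + v \<in> Z"
      using that by (auto simp: linear_add_map intro: subspace_add)
    then show "u = v" using that by (auto simp: add_eq_0_iff_eq)
  qed
  have bound: "finite Z \<and> card Z \<le> card (range f)" if "P Z" for Z
  proof -
    have "inj_on f Z" using that f inj by (auto simp: P_def)
    then show ?thesis
      using fin by (metis card_inj_on_le finite_subset finite_imageD image_mono subset_UNIV)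
  qed
  have "P {0}" using K by (auto simp: P_def subspace_0)
  then obtain Z where Z: "P Z" and max: "\<And>Y. P Y \<Longrightarrow> card Y \<le> card Z"
    using ex_has_greatest_nat[of P "{0}" card "Suc (card (range f))"] bound
    by (metis less_Suc_eq_le)
  have sub: "subspace Z" "Z \<subseteq> K" and finZ: "finite Z" using Z bound by (auto simp: P_def)
  have "card Z = card (range f)"
  proof (rule ccontr)
    assume "card Z \<noteq> card (range f)"
    then have less: "card Z < card (range f)" using bound[OF Z] by simp
    have "f ` Z \<noteq> f ` K" "g ` Z \<noteq> g ` K"
      using less card_image_le[OF finZ, of f] card_image_le[OF finZ, of g] fK gK card_eq by auto
    then obtain k1 k2 where k1: "k1 \<in> K" "f k1 \<notin> f ` Z" and k2: "k2 \<in> K" "g k2 \<notin> g ` Z"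
      using sub by blast
    have cancel: "h b \<notin> h ` Z \<Longrightarrow> h a \<in> h ` Z \<Longrightarrow> h (a + b) \<notin> h ` Z"
      if h: "Vector_Spaces.linear s s h" for h a b
    proof
      assume b: "h b \<notin> h ` Z" and "h a \<in> h ` Z" "h (a + b) \<in> h ` Z"
      then obtain u v where uv: "u \<in> Z" "v \<in> Z" "h a = h u" "h (a + b) = h v" by auto
      then have "h b = h (u + v)"
        by (metis add_self_left linear_add_map[OF h])
      with uv b sub show False by (auto intro: subspace_add)
    qed
    obtain k where k: "k \<in> K" "f k \<notin> f ` Z" "g k \<notin> g ` Z"
    proof (cases "g k1 \<notin> g ` Z \<or> f k2 \<notin> f ` Z")
      case True
      then show ?thesis using that k1 k2 by blast
    next
      case False
      then have "f (k2 + k1) \<notin> f ` Z" "g (k1 + k2) \<notin> g ` Z"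
        using k1 k2 cancel f g by blast+
      then show ?thesis
        using that[of "k1 + k2"] k1 k2 K by (auto simp: add.commute intro: subspace_add)
    qed
    define Y where "Y = Z \<union> (\<lambda>z. z + k) ` Z"
    have "subspace Y"
    proof (rule subspaceI_add)
      show "0 \<in> Y" using sub by (auto simp: Y_def subspace_0)
      fix u v assume "u \<in> Y" "v \<in> Y"
      then consider "u \<in> Z" "v \<in> Z" | a where "u \<in> Z" "v = a + k" "a \<in> Z"
        | a where "u = a + k" "a \<in> Z" "v \<in> Z" | a b where "u = a + k" "a \<in> Z" "v = b + k" "b \<in> Z"
        by (auto simp: Y_def)
      then show "u + v \<in> Y"
      proof cases
        case (2 a)
        then have "u + v = (u + a) + k" "u + a \<in> Z"
          using sub by (auto simp: ac_simps intro: subspace_add)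
        then show ?thesis by (auto simp: Y_def)
      next
        case (3 a)
        then have "u + v = (a + v) + k" "a + v \<in> Z"
          using sub by (auto simp: ac_simps intro: subspace_add)
        then show ?thesis by (auto simp: Y_def)
      next
        case (4 a b)
        then have "u + v = a + b" "a + b \<in> Z"
          using sub by (auto simp: ac_simps intro: subspace_add)
        then show ?thesis by (auto simp: Y_def)
      qed (use sub in \<open>auto simp: Y_def intro: subspace_add\<close>)
    qed
    moreover have "Y \<subseteq> K"
      using sub K k by (auto simp: Y_def intro: subspace_add)
    \<comment> \<open>If \<open>f (z + k) = 0\<close> with \<open>z\<close> in \<open>Z\<close>,
      then \<open>f k = f z\<close>, against the choice of \<open>k\<close>; the same holds for
      \<open>g\<close>.\<close>
    moreover have "\<forall>z\<in>Y. f z = 0 \<longrightarrow> z = 0" "\<forall>z\<in>Y. g z = 0 \<longrightarrow> z = 0"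
      using Z k by (auto simp: Y_def P_def add_f add_g add_eq_0_iff_eq image_iff)
    ultimately have "P Y" by (simp add: P_def)
    moreover have "k \<notin> Z" "k \<in> Y"
      using k sub by (auto simp: Y_def intro!: image_eqI[of k _ 0] subspace_0)
    then have "Z \<subset> Y" by (auto simp: Y_def)
    then have "card Z < card Y" using bound[OF \<open>P Y\<close>] by (simp add: psubset_card_mono)
    ultimately show False using max[of Y] by simp
  qed
  then show ?thesis using that Z finZ by (auto simp: P_def)
qed

section \<open>Alternating bilinear maps and the intersection of two images\<close>

definition alternating_bilinear :: "('a \<Rightarrow> 'a \<Rightarrow> 'a) \<Rightarrow> bool" where
  "alternating_bilinear b \<longleftrightarrow> (\<forall>x. Vector_Spaces.linear s s (b x)) \<and>
     (\<forall>y. Vector_Spaces.linear s s (\<lambda>x. b x y)) \<and> (\<forall>x. b x x = 0)"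

lemma alternating_bilinear_linear:
  "alternating_bilinear b \<Longrightarrow> Vector_Spaces.linear s s (b x)"
  by (simp add: alternating_bilinear_def)

lemma alternating_bilinear_add_right:
  "alternating_bilinear b \<Longrightarrow> b x (y + z) = b x y + b x z"
  by (simp add: alternating_bilinear_def linear_add_map)

lemma alternating_bilinear_add_left:
  "alternating_bilinear b \<Longrightarrow> b (x + y) z = b x z + b y z"
  using linear_add_map[of "\<lambda>x. b x z"] by (simp add: alternating_bilinear_def)

lemma alternating_bilinear_self: "alternating_bilinear b \<Longrightarrow> b x x = 0"
  by (simp add: alternating_bilinear_def)

lemma alternating_bilinear_zero:
  assumes "alternating_bilinear b"
  shows "b x 0 = 0" "b 0 x = 0"
  using alternating_bilinear_add_right[OF assms, of x 0 0]
    alternating_bilinear_add_left[OF assms, of 0 0 x] by simp_all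

lemma alternating_bilinear_commute:
  assumes "alternating_bilinear b"
  shows "b x y = b y x"
proof -
  have "0 = b (x + y) (x + y)"
    by (rule alternating_bilinear_self[OF assms, symmetric])
  also have "\<dots> = b y x + b x y"
    unfolding alternating_bilinear_add_left[OF assms] alternating_bilinear_add_right[OF assms]
    by (simp add: alternating_bilinear_self[OF assms])
  finally show ?thesis
    using add_eq_0_iff_eq by metis
qed

lemma subspace_range_linear:
  assumes "Vector_Spaces.linear s s f"
  shows "subspace (range f)"
proof (rule subspaceI_add)
  show "0 \<in> range f" using linear_zero_map[OF assms] by (metis rangeI)
  show "u + v \<in> range f" if "u \<in> range f" "v \<in> range f" for u v
    using that by (auto simp flip: linear_add_map[OF assms])
qed

text \<open>If the images of \<open>b x\<close> and \<open>b y\<close> met trivially, count the pairs \<open>(z, v)\<close> in \<open>Z \<times> Z\<close> with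
  \<open>v \<noteq> 0\<close> and \<open>b (y + z) v \<in> range (b x)\<close>, where \<open>Z\<close> is a common complement of the two kernels.
  For fixed \<open>v\<close> the admissible \<open>z\<close> are permuted by \<open>z \<mapsto> z + v\<close>, so the count is even; for fixed
  \<open>z\<close> the admissible \<open>v\<close> are the nonzero elements of a subspace that vanishes only for \<open>z = 0\<close>,
  so the count is odd.\<close>
lemma images_meet:
  assumes b: "alternating_bilinear b" and K: "subspace K"
    and Kx: "b x ` K = range (b x)" and Ky: "b y ` K = range (b y)"
    and fin: "finite (range (b x))" and card_eq: "card (range (b y)) = card (range (b x))"
    and gt1: "card (range (b x)) > 1"
    and bound: "\<And>k. k \<in> K \<Longrightarrow> finite (range (b (y + k))) \<and> card (range (b (y + k))) \<le> card (range (b x))"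
  shows "range (b x) \<inter> range (b y) \<noteq> {0}"
proof
  assume triv: "range (b x) \<inter> range (b y) = {0}"
  note lin = alternating_bilinear_linear[OF b]
  note bil = alternating_bilinear_add_left[OF b] alternating_bilinear_add_right[OF b]
    alternating_bilinear_self[OF b] alternating_bilinear_zero[OF b]
  \<comment> \<open>By symmetry \<open>b x y = b y x\<close> lies in both images.\<close>
  have xy: "b x y = 0" "b y x = 0"
    using triv alternating_bilinear_commute[OF b, of x y] by (metis IntI rangeI singletonD)+
  obtain Z where Z: "subspace Z" "Z \<subseteq> K" "finite Z" "card Z = card (range (b x))"
    and Zx: "\<And>z. z \<in> Z \<Longrightarrow> b x z = 0 \<Longrightarrow> z = 0" and Zy: "\<And>z. z \<in> Z \<Longrightarrow> b y z = 0 \<Longrightarrow> z = 0"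
    using common_complement[OF lin lin K Kx Ky fin card_eq] by blast
  note subx = subspace_range_linear[OF lin, of x]
  define N where "N z = {v \<in> Z. b (y + z) v \<in> range (b x)}" for z
  have subN: "subspace (N z)" for z
  proof (rule subspaceI_add)
    show "0 \<in> N z"
      using subspace_0[OF Z(1)] subspace_0[OF subx] by (simp add: N_def bil)
    show "u + v \<in> N z" if "u \<in> N z" "v \<in> N z" for u v
      using that subspace_add[OF Z(1)] subspace_add[OF subx]
      by (simp add: N_def alternating_bilinear_add_right[OF b])
  qed
  have finN: "finite (N z)" for z using Z(3) by (simp add: N_def)
  have N0: "N 0 = {0}"
  proof -
    have "v = 0" if "v \<in> N 0" for v
    proof -
      have "v \<in> Z" "b y v \<in> range (b x) \<inter> range (b y)" using that by (auto simp: N_def)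
      then show ?thesis using Zy triv by auto
    qed
    then show ?thesis using subspace_0[OF subN, of 0] by auto
  qed
  \<comment> \<open>If \<open>N z\<close> were trivial, \<open>b (y + z)\<close> would be injective
    on \<open>Z\<close>, so its values there would already number as many as \<open>bound\<close>
    allows. But \<open>b (y + z) x = b x z\<close> is a nonzero element of
    \<open>range (b x)\<close>, and a preimage of it in \<open>Z\<close> would be a nonzero element
    of \<open>N z\<close>; so it is one value too many.\<close>
  have N_nontriv: "\<exists>v\<in>N z. v \<noteq> 0" if z: "z \<in> Z" "z \<noteq> 0" for z
  proof (rule ccontr)
    assume contra: "\<not> (\<exists>v\<in>N z. v \<noteq> 0)"
    have inj: "inj_on (b (y + z)) Z"
    proof (rule inj_onI)
      fix u v assume uv: "u \<in> Z" "v \<in> Z" "b (y + z) u = b (y + z) v"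
      then have "b (y + z) (u + v) = 0" by (simp add: alternating_bilinear_add_right[OF b])
      then have "u + v \<in> N z"
        using uv Z(1) subspace_0[OF subx] by (auto simp: N_def intro: subspace_add)
      then show "u = v" using contra add_eq_0_iff_eq by blast
    qed
    have "b (y + z) x = b x z"
      by (simp add: bil xy alternating_bilinear_commute[OF b, of z x])
    then have x: "b (y + z) x \<in> range (b x)" "b (y + z) x \<noteq> 0" using Zx z by auto
    have "b (y + z) x \<notin> b (y + z) ` Z"
    proof
      assume "b (y + z) x \<in> b (y + z) ` Z"
      then obtain v where "v \<in> Z" "b (y + z) x = b (y + z) v" by blast
      then have "v \<in> N z" "v \<noteq> 0" using x bil(4) by (auto simp: N_def)
      with contra show False by blast
    qed
    then have "b (y + z) ` Z \<subset> range (b (y + z))" by blast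
    then have "card (b (y + z) ` Z) < card (range (b (y + z)))"
      using bound[of z] z Z(2) by (intro psubset_card_mono) auto
    then show False using bound[of z] z Z inj by (auto simp: card_image)
  qed
  have "even (card (SIGMA v:Z - {0}. {z \<in> Z. v \<in> N z}))"
  proof -
    have "even (card {z \<in> Z. v \<in> N z})" if "v \<in> Z - {0}" for v
    proof (rule even_card_translation_invariant[of v])
      fix z assume z: "z \<in> {z \<in> Z. v \<in> N z}"
      \<comment> \<open>The additional term is \<open>b v v = 0\<close>; hence the condition on
        \<open>z\<close> is invariant under translation by \<open>v\<close>.\<close>
      have "b (y + (z + v)) v = b (y + z) v"
        by (simp add: bil)
      then show "z + v \<in> {z \<in> Z. v \<in> N z}"
        using z subspace_add[OF Z(1)] by (simp add: N_def)
    qed (use that in simp)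
    then show ?thesis using Z(3) by (auto simp: card_SigmaI intro!: dvd_sum)
  qed
  moreover have "card (SIGMA v:Z - {0}. {z \<in> Z. v \<in> N z}) = card (SIGMA z:Z. N z - {0})"
  proof -
    have "(SIGMA z:Z. N z - {0}) = prod.swap ` (SIGMA v:Z - {0}. {z \<in> Z. v \<in> N z})"
      by (auto simp: N_def)
    then show ?thesis by (simp add: card_image)
  qed
  moreover have "odd (card (SIGMA z:Z. N z - {0}))"
  proof -
    have Z0: "0 \<in> Z" using Z(1) by (rule subspace_0)
    obtain w where w: "w \<in> Z" "w \<noteq> 0"
    proof (rule ccontr)
      assume "\<not> thesis"
      then have "Z \<subseteq> {0}" using that by blast
      then have "card Z \<le> 1" using card_mono[of "{0}" Z] by simp
      with gt1 Z(4) show False by simp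
    qed
    have "odd (card (N z - {0}))" if z: "z \<in> Z - {0}" for z
    proof -
      obtain v where "v \<in> N z" "v \<noteq> 0" using N_nontriv z by blast
      then have "even (card (N z))" using even_card_subspace subN by blast
      moreover have "0 \<in> N z" using subN by (rule subspace_0)
      ultimately show ?thesis
        using finN[of z] by (metis card.remove even_Suc)
    qed
    then have "{z \<in> Z - {0}. odd (card (N z - {0}))} = Z - {0}" by blast
    \<comment> \<open>All summands are odd, so the sum has the parity of the number of nonzero
      \<open>z\<close>, which is odd because \<open>card Z\<close> is even.\<close>
    then have "even (\<Sum>z\<in>Z - {0}. card (N z - {0})) \<longleftrightarrow> even (card (Z - {0}))"
      using Z(3) by (subst even_sum_iff) simp_all
    moreover have "odd (card (Z - {0}))"
      using even_card_subspace[OF Z(1) w] Z0 Z(3) by (metis card.remove even_Suc)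
    moreover have "card (SIGMA z:Z. N z - {0}) = (\<Sum>z\<in>Z - {0}. card (N z - {0}))"
      using Z(3) finN Z0 N0 by (simp add: card_SigmaI sum.remove[of Z 0])
    ultimately show ?thesis by simp
  qed
  ultimately show False by simp
qed

section \<open>Reduction modulo a subspace and the bound for the span of all values\<close>

lemma card_image_half:
  assumes f: "Vector_Spaces.linear s s f" and S: "subspace S" "finite S"
    and w: "w \<in> S" "w \<noteq> 0" "f w = 0"
  shows "2 * card (f ` S) \<le> card S"
proof -
  \<comment> \<open>Every fibre in \<open>S\<close> is closed under translation by the kernel vector
    \<open>w\<close>, so it contains both \<open>u\<close> and \<open>u + w\<close>.\<close>
  have two: "2 \<le> card {u \<in> S. f u = t}" if t: "t \<in> f ` S" for t
  proof -
    obtain u where u: "u \<in> S" "f u = t" using t by blast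
    have "{u, u + w} \<subseteq> {u \<in> S. f u = t}"
      using u w S by (auto simp: linear_add_map[OF f] intro: subspace_add)
    then have "card {u, u + w} \<le> card {u \<in> S. f u = t}"
      using S by (intro card_mono) auto
    then show ?thesis using w by (simp add: card_insert_if)
  qed
  have "2 * card (f ` S) = (\<Sum>t\<in>f ` S. 2)" by simp
  also have "\<dots> \<le> (\<Sum>t\<in>f ` S. card {u \<in> S. f u = t})"
    by (rule sum_mono) (rule two)
  also have "\<dots> = card S"
    unfolding card_eq_sum by (rule sum.image_gen[OF S(2), symmetric])
  finally show ?thesis .
qed

text \<open>\<open>q\<close> models the quotient map by \<open>U\<close> without leaving the type:
  its kernel is \<open>U\<close>, and \<open>q w\<close> represents the class of \<open>w\<close>.
  It is the identity plus a projection onto \<open>U\<close>.\<close>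

lemma projection_along_subspace:
  assumes "subspace U"
  obtains q where "Vector_Spaces.linear s s q" "\<And>u. u \<in> U \<Longrightarrow> q u = 0" "\<And>w. w + q w \<in> U"
proof -
  interpret vector_space_pair s s ..
  have "\<exists>p. p ` UNIV \<subseteq> U \<and> Vector_Spaces.linear s s p \<and> (\<forall>v\<in>U. p (id v) = v)"
    by (rule linear_exists_left_inverse_on[OF linear_id assms inj_on_id])
  then obtain p where p: "\<And>w. p w \<in> U" "Vector_Spaces.linear s s p" "\<And>v. v \<in> U \<Longrightarrow> p v = v"
    by (metis UNIV_I id_apply image_subset_iff)
  show ?thesis
  proof
    show "Vector_Spaces.linear s s (\<lambda>x. x + p x)"
      using linear_compose_add[OF linear_id p(2)] by simp
    show "u + p u = 0" if "u \<in> U" for u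
      using p(3)[OF that] by simp
    show "w + (w + p w) \<in> U" for w
      using p(1) by simp
  qed
qed

text \<open>The cardinality of a finite subspace is a power of 2, so it cannot lie strictly between
  consecutive powers.\<close>

lemma finite_subspace_card_gt:
  assumes "subspace S" "finite S" "card S > 2 ^ k"
  shows "card S \<ge> 2 ^ Suc k"
proof -
  obtain B where "span B = S" "card S = 2 ^ card B"
    using finite_subspace_basis[OF assms(1,2)] by blast
  with assms(3) have "Suc k \<le> card B" by simp
  then show ?thesis unfolding \<open>card S = _\<close> by (rule power_increasing) simp
qed

text \<open>The exponent is \<open>1 + \<dots> + m\<close>. In the induction \<open>h\<close> stays
  fixed, while \<open>b\<close> is replaced by its reduction modulo one image and \<open>H\<close>
  by another hyperplane; hence both are generalized.\<close>

theorem card_span_alternating_le: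
  assumes "alternating_bilinear b" "hyperplane H"
    and "subspace h" "\<And>y. span (insert y h) \<noteq> UNIV"
    and "\<And>u. u \<notin> H \<Longrightarrow> u \<notin> h \<Longrightarrow> finite (range (b u)) \<and> card (range (b u)) \<le> 2 ^ m"
  shows "finite (span {b u v | u v. True}) \<and> card (span {b u v | u v. True}) \<le> 2 ^ (m * (m + 1) div 2)"
  using assms
proof (induction m arbitrary: b H)
  case 0
  note b = 0(1) and H = 0(2) and h = 0(3,4)
  obtain y where y: "y \<notin> H" "y \<notin> h"
    using exists_outside_both[OF H h] by blast
  obtain H' where H': "hyperplane H'" "h \<subseteq> H'" "y \<in> H'"
    using hyperplane_above[OF h] by blast
  have zero: "b u v = 0" if u: "u \<notin> H" "u \<notin> h" for u v
  proof -
    have "finite (range (b u))" "card (range (b u)) \<le> 1" using 0(5)[OF u] by auto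
    moreover have "b u 0 = 0" using alternating_bilinear_zero[OF b] by blast
    ultimately show ?thesis by (metis card_le_Suc0_iff_eq One_nat_def rangeI)
  qed
  \<comment> \<open>For \<open>u\<close> in \<open>H\<close>, write \<open>u\<close> as the sum of
    \<open>u + y\<close> and \<open>y\<close>, both of which lie outside \<open>H\<close> and
    \<open>h\<close>.\<close>
  have zero': "b u v = 0" if u: "u \<notin> H'" for u v
  proof (cases "u \<in> H")
    case True
    have "u + y \<notin> H" "u + y \<notin> H'"
      using True u y H'(3) by (auto simp: hyperplane_add_iff[OF H] hyperplane_add_iff[OF H'(1)])
    then have "u + y \<notin> H" "u + y \<notin> h" using H'(2) by auto
    then show ?thesis
      using zero[of "u + y" v] zero[OF y, of v] by (simp add: alternating_bilinear_add_left[OF b])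
  qed (use zero u H' in blast)
  \<comment> \<open>An element of \<open>H'\<close> is the sum of two elements outside it.\<close>
  have "b u v = 0" for u v
  proof (cases "u \<in> H'")
    case True
    have "H' \<noteq> UNIV" using H'(1) by (simp add: hyperplane_def)
    then obtain w where "w \<notin> H'" by blast
    moreover from this True H' have "u + w \<notin> H'" by (simp add: hyperplane_add_iff)
    ultimately show ?thesis
      using zero'[of "u + w" v] zero'[of w v] by (simp add: alternating_bilinear_add_left[OF b])
  qed (use zero' in blast)
  then have "{b u v | u v. True} = {0}" by auto
  then show ?case by simp
next
  case (Suc m)
  note b = Suc.prems(1) and H = Suc.prems(2) and h = Suc.prems(3,4) and bound = Suc.prems(5)
  note lin = alternating_bilinear_linear[OF b]
  let ?W = "span {b u v | u v. True}"
  have tri: "Suc m * (Suc m + 1) div 2 = Suc m + m * (m + 1) div 2"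
    by (simp add: algebra_simps)
  show ?case
  proof (cases "\<forall>u. u \<notin> H \<longrightarrow> u \<notin> h \<longrightarrow> card (range (b u)) \<le> 2 ^ m")
    case True
    have "finite ?W \<and> card ?W \<le> 2 ^ (m * (m + 1) div 2)"
      using Suc.IH[OF b H h] True bound by blast
    moreover have "(2::nat) ^ (m * (m + 1) div 2) \<le> 2 ^ (Suc m * (Suc m + 1) div 2)"
      unfolding tri by (intro power_increasing) auto
    ultimately show ?thesis by linarith
  next
    case False
    then obtain y where y: "y \<notin> H" "y \<notin> h" "card (range (b y)) > 2 ^ m" by force
    let ?I = "range (b y)"
    have I: "subspace ?I" "finite ?I" "card ?I = 2 ^ Suc m"
      using bound[OF y(1,2)] finite_subspace_card_gt[OF subspace_range_linear[OF lin] _ y(3)]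
        subspace_range_linear[OF lin] by auto
    \<comment> \<open>\<open>H'\<close> contains \<open>h\<close> and \<open>y\<close>, so
      translation by \<open>y\<close> preserves the complement of \<open>H'\<close>, which is
      disjoint from \<open>h\<close>.\<close>
    obtain H' where H': "hyperplane H'" "h \<subseteq> H'" "y \<in> H'"
      using hyperplane_above[OF h] by blast
    obtain q where q: "Vector_Spaces.linear s s q" "\<And>u. u \<in> ?I \<Longrightarrow> q u = 0" "\<And>w. w + q w \<in> ?I"
      using projection_along_subspace[OF I(1)] by blast
    define c where "c u v = q (b u v)" for u v
    have c: "alternating_bilinear c"
      using b q(1) linear_zero_map[OF q(1)]
      unfolding alternating_bilinear_def c_def Vector_Spaces.linear_iff by simp
    have c_bound: "finite (range (c x)) \<and> card (range (c x)) \<le> 2 ^ m"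
      if x: "x \<notin> H'" "x \<notin> H" for x
    proof -
      have xh: "x \<notin> h" using x H' by blast
      have X: "subspace (range (b x))" "finite (range (b x))" "card (range (b x)) \<le> 2 ^ Suc m"
        using bound[OF x(2) xh] subspace_range_linear[OF lin] by auto
      have rc: "range (c x) = q ` range (b x)" by (auto simp: c_def)
      have "card (range (c x)) \<le> 2 ^ m"
      \<comment> \<open>A nonzero common vector is killed by \<open>q\<close>, which halves the
        image. A trivial intersection together with a large image of \<open>c x\<close> will
        contradict \<open>images_meet\<close>.\<close>
      proof (cases "range (b x) \<inter> ?I = {0}")
        case False
        then obtain w where "w \<in> range (b x)" "w \<in> ?I" "w \<noteq> 0"
          using subspace_0[OF X(1)] subspace_0[OF I(1)] by blast
        then show ?thesis
          using card_image_half[OF q(1) X(1,2), of w] q(2) X(3) by (simp add: rc)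
      next
        case True
        show ?thesis
        proof (rule ccontr)
          assume "\<not> ?thesis"
          then have "card (range (b x)) > 2 ^ m"
            using card_image_le[OF X(2), of q] unfolding rc by linarith
          then have card_x: "card (range (b x)) = 2 ^ Suc m"
            using finite_subspace_card_gt[OF X(1,2), of m] X(3) by simp
          \<comment> \<open>This yields a hyperplane \<open>L\<close> that contains \<open>x\<close>
            and \<open>h\<close> but not \<open>y\<close>. For \<open>k\<close> in
            \<open>H \<inter> L\<close> the vector \<open>y + k\<close> then stays outside both
            \<open>H\<close> and \<open>h\<close>, where \<open>bound\<close> applies.\<close>
          have "y \<notin> span (insert x h)"
          proof
            assume "y \<in> span (insert x h)"
            then have "y \<in> h \<or> y + x \<in> h"
              using span_insert_cases[of y x h] span_eq_iff h(1) by metis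
            then show False using y x H' hyperplane_add_iff[OF H'(1), of y x] by blast
          qed
          then obtain L where L: "hyperplane L" "span (insert x h) \<subseteq> L" "y \<notin> L"
            using separating_hyperplane[OF subspace_span] by blast
          have xL: "x \<in> L" and hL: "h \<subseteq> L"
            using L(2) span_superset[of "insert x h"] by auto
          let ?K = "H \<inter> L"
          have K: "subspace ?K"
            using H L by (auto simp: hyperplane_def intro: subspace_inter)
          have "b x y \<in> range (b x) \<inter> ?I"
            using alternating_bilinear_commute[OF b, of x y] by (metis IntI rangeI)
          then have xy: "b x y = 0" "b y x = 0"
            using True alternating_bilinear_commute[OF b, of x y] by auto
          have onto: "b u ` ?K = range (b u)" if u: "b u x = 0" "b u y = 0" for u
          proof (intro equalityI subsetI)
            fix t assume "t \<in> range (b u)"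
            then obtain v where v: "t = b u v" by blast
            \<comment> \<open>The vectors \<open>0\<close>, \<open>x\<close>, \<open>y\<close>,
              \<open>x + y\<close> represent the four classes modulo \<open>H \<inter> L\<close>:
              \<open>x\<close> is outside \<open>H\<close> only, \<open>y\<close> outside both, and
              \<open>x + y\<close> outside \<open>L\<close> only. All four are killed by
              \<open>b u\<close>.\<close>
            have "\<exists>w\<in>{0, x, y, x + y}. v + w \<in> ?K"
              using x(2) y(1) xL L(3) subspace_0[OF K]
              by (auto simp: hyperplane_add_iff[OF H] hyperplane_add_iff[OF L(1)])
            then obtain w where w: "w \<in> {0, x, y, x + y}" "v + w \<in> ?K" by blast
            have "b u w = 0"
              using w(1) u
              by (auto simp: alternating_bilinear_add_right[OF b] alternating_bilinear_zero[OF b])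
            then have "t = b u (v + w)" using v by (simp add: alternating_bilinear_add_right[OF b])
            with w(2) show "t \<in> b u ` ?K" by blast
          qed auto
          have "range (b x) \<inter> ?I \<noteq> {0}"
          proof (rule images_meet[OF b K])
            show "b x ` ?K = range (b x)" "b y ` ?K = range (b y)"
              using xy alternating_bilinear_self[OF b] by (auto intro!: onto)
            show "card (range (b x)) > 1" unfolding card_x by (rule one_less_power) auto
            fix k assume k: "k \<in> ?K"
            have "y + k \<notin> H" "y + k \<notin> h"
              using k y L(3) hL hyperplane_add_iff[OF H, of y k] hyperplane_add_iff[OF L(1), of y k]
              by auto
            then show "finite (range (b (y + k))) \<and> card (range (b (y + k))) \<le> card (range (b x))"
              using bound card_x by simp
          qed (use X I card_x in auto)
          with True show False by blast
        qed
      qed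
      then show ?thesis using X(2) rc by simp
    qed
    \<comment> \<open>The values of \<open>b y\<close> lie in the kernel of \<open>q\<close>. Thus
      for \<open>x\<close> in \<open>H\<close> but outside \<open>H'\<close> the bound can be taken
      from \<open>x + y\<close>, which is outside both.\<close>
    have c_add_y: "c (x + y) = c x" for x
      by (auto simp: c_def alternating_bilinear_add_left[OF b] linear_add_map[OF q(1)] q(2))
    have "finite (range (c x)) \<and> card (range (c x)) \<le> 2 ^ m" if "x \<notin> H'" for x
      using c_bound[of x] c_bound[of "x + y"] that y H'(3)
        hyperplane_add_iff[OF H, of x y] hyperplane_add_iff[OF H'(1), of x y]
      unfolding c_add_y by blast
    then have IH: "finite (span {c u v | u v. True})" "card (span {c u v | u v. True}) \<le> 2 ^ (m * (m + 1) div 2)"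
      using Suc.IH[OF c H'(1) h] by auto
    have qW: "q ` ?W = span {c u v | u v. True}"
    proof -
      interpret vector_space_pair s s ..
      have "{c u v | u v. True} = q ` {b u v | u v. True}" by (auto simp: c_def)
      then show ?thesis using linear_span_image[OF q(1)] by simp
    qed
    \<comment> \<open>Each \<open>w\<close> splits as \<open>q w\<close> plus an element of
      \<open>?I\<close>, so \<open>card ?W\<close> is at most the product of the two
      cardinalities.\<close>
    have W_sub: "?W \<subseteq> (\<lambda>(t, i). t + i) ` (q ` ?W \<times> ?I)"
    proof
      fix w assume "w \<in> ?W"
      moreover have "w = q w + (w + q w)" by (simp add: ac_simps)
      ultimately show "w \<in> (\<lambda>(t, i). t + i) ` (q ` ?W \<times> ?I)"
        using q(3)[of w] by (intro image_eqI[of w _ "(q w, w + q w)"]) auto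
    qed
    have fin: "finite (q ` ?W \<times> ?I)" using IH I qW by simp
    have "card ?W \<le> card (q ` ?W \<times> ?I)"
      using W_sub fin by (meson card_image_le card_mono finite_imageI le_trans)
    also have "\<dots> \<le> 2 ^ (m * (m + 1) div 2) * 2 ^ Suc m"
      using IH I unfolding qW by (simp add: card_cartesian_product)
    also have "\<dots> = 2 ^ (Suc m * (Suc m + 1) div 2)"
      unfolding tri by (simp add: power_add)
    finally show ?thesis using W_sub fin by (meson finite_imageI finite_subset)
  qed
qed

end

section \<open>From codimension and breadth to cardinalities, and the Lie algebra statement\<close>

lemma (in bit_vector_space) card_range_le_of_codim_kernel:
  assumes f: "Vector_Spaces.linear s s f" and "codim s {y. f y = 0} \<le> enat m"
  shows "finite (range f) \<and> card (range f) \<le> 2 ^ m"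
proof -
  let ?E = "{enat (card B) | B. finite B \<and> span ({y. f y = 0} \<union> B) = UNIV}"
  have "?E \<noteq> {}"
  proof
    assume "?E = {}"
    then have "codim s {y. f y = 0} = \<infinity>" by (simp only: codim_def Inf_enat_def simp_thms if_True)
    with assms(2) show False by simp
  qed
  \<comment> \<open>By well-ordering the infimum of a nonempty set in \<open>enat\<close> is
    attained, which gives an actual set \<open>B\<close> that completes the kernel.\<close>
  then have "Inf ?E \<in> ?E" by (metis (mono_tags, lifting) wellorder_InfI ex_in_conv)
  then obtain B where B: "finite B" "span ({y. f y = 0} \<union> B) = UNIV" "enat (card B) \<le> enat m"
    using assms(2) unfolding codim_def by auto
  interpret vector_space_pair s s ..
  have "range f = f ` span ({y. f y = 0} \<union> B)" using B by simp
  also have "\<dots> = span (f ` ({y. f y = 0} \<union> B))" using linear_span_image[OF f] by simp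
  \<comment> \<open>The kernel contributes only 0, so the images of the completing vectors span the
    range.\<close>
  also have "\<dots> \<subseteq> span (insert 0 (f ` B))" by (intro span_mono) auto
  finally have sub: "range f \<subseteq> span (f ` B)" by simp
  have fin: "finite (span (f ` B))" "card (span (f ` B)) \<le> 2 ^ card (f ` B)"
    using card_span_le[of "f ` B"] B(1) by auto
  have "card (range f) \<le> 2 ^ card (f ` B)" using card_mono[OF fin(1) sub] fin(2) by simp
  also have "\<dots> \<le> 2 ^ m"
    using card_image_le[OF B(1), of f] B(3) by (intro power_increasing) auto
  finally show ?thesis using fin sub finite_subset by blast
qed

theorem theorem1p3:
  fixes s :: "bit \<Rightarrow> 'a::ab_group_add \<Rightarrow> 'a" and br :: "'a \<Rightarrow> 'a \<Rightarrow> 'a" and n :: nat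
  assumes "lie_algebra s br"
    and "nilpotent_lie s br"
    and "edim s (derived s br) > enat (n * (n - 1) div 2)"
  shows "\<not> (\<exists>h1 h2. lie_subalgebra s br h1 \<and> h1 \<noteq> UNIV \<and>
                   lie_subalgebra s br h2 \<and> h2 \<noteq> UNIV \<and> codim s h2 \<ge> 2 \<and>
                   (\<forall>x. breadth s br x \<ge> enat n \<longrightarrow> x \<in> h1 \<union> h2))"
proof
  assume "\<exists>h1 h2. lie_subalgebra s br h1 \<and> h1 \<noteq> UNIV \<and>
                   lie_subalgebra s br h2 \<and> h2 \<noteq> UNIV \<and> codim s h2 \<ge> 2 \<and>
                   (\<forall>x. breadth s br x \<ge> enat n \<longrightarrow> x \<in> h1 \<union> h2)"
  then obtain h1 h2 where h1: "lie_subalgebra s br h1" "h1 \<noteq> UNIV"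
    and h2: "lie_subalgebra s br h2" "codim s h2 \<ge> 2"
    and cover: "\<And>x. x \<notin> h1 \<Longrightarrow> x \<notin> h2 \<Longrightarrow> breadth s br x < enat n"
    by (metis Un_iff not_le)
  interpret bit_vector_space s
    using assms(1) by (simp add: lie_algebra_def bit_vector_space_def)
  have br: "alternating_bilinear br"
    using assms(1) by (simp add: lie_algebra_def alternating_bilinear_def)
  have sub: "subspace h1" "subspace h2"
    using h1 h2 by (auto simp: lie_subalgebra_def)
  obtain H where H: "hyperplane H" "h1 \<subseteq> H"
    using separating_hyperplane[OF sub(1)] h1(2) by blast
  have large: "span (insert y h2) \<noteq> UNIV" for y
  proof
    assume "span (insert y h2) = UNIV"
    then have "codim s h2 \<le> enat (card {y})"
      unfolding codim_def by (intro Inf_lower CollectI exI[of _ "{y}"]) auto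
    with h2(2) show False by (auto simp: numeral_eq_enat dest: order_trans)
  qed
  \<comment> \<open>An element outside \<open>H\<close> and \<open>h2\<close> has breadth below
    \<open>n\<close>; this rules out \<open>n = 0\<close> and permits
    \<open>m = n - 1\<close>.\<close>
  obtain x where "x \<notin> H" "x \<notin> h2"
    using exists_outside_both[OF H(1) sub(2) large] by blast
  then have "breadth s br x < enat n" using cover H(2) by blast
  then obtain m where m: "n = Suc m"
    by (metis not0_implies_Suc not_less_zero zero_enat_def)
  have "finite (range (br u)) \<and> card (range (br u)) \<le> 2 ^ m" if u: "u \<notin> H" "u \<notin> h2" for u
  proof (rule card_range_le_of_codim_kernel[OF alternating_bilinear_linear[OF br]])
    have "breadth s br u < enat (Suc m)" using cover u H(2) m by blast
    then show "codim s {y. br u y = 0} \<le> enat m"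
      by (cases "codim s {y. br u y = 0}") (auto simp: breadth_def centralizer_def)
  qed
  then have W: "finite (derived s br)" "card (derived s br) \<le> 2 ^ (m * (m + 1) div 2)"
    using card_span_alternating_le[OF br H(1) sub(2) large] unfolding derived_def by blast+
  have "subspace (derived s br)" by (simp add: derived_def)
  then obtain B where B: "finite B" "B \<subseteq> derived s br" "span B = derived s br"
    "card (derived s br) = 2 ^ card B"
    using finite_subspace_basis[OF _ W(1)] by blast
  have "edim s (derived s br) \<le> enat (card B)"
    unfolding edim_def using B by (intro Inf_lower) blast
  moreover have "card B \<le> m * (m + 1) div 2"
    using W(2) B(4) by simp
  ultimately have "edim s (derived s br) \<le> enat (n * (n - 1) div 2)"
    by (metis m diff_Suc_1 Suc_eq_plus1 enat_ord_simps(1) mult.commute order_trans)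
  with assms(3) show False by simp
qed

end
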